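(* Let $\mathcal{A}$ be the arc set of the transportation network, and let $n_{ij}$, $\boldsymbol{\theta}_{ij}=(1,\dots,n_{ij})$, $\beta^0_{ij}$ and $\boldsymbol{\beta}_{ij}=(\beta^{(1)}_{ij},\dots,\beta^{(n_{ij})}_{ij})$ be, for each arc $(i,j)\in\mathcal{A}$, the lane total, the thresholds, and the intercept and slopes of the piecewise affine and convex approximation of the arc's cost, as described in the context. Consider the integer program $\displaystyle \min_{\boldsymbol{\varepsilon}} \ \hat J(\boldsymbol{\varepsilon}) := \sum_{(i,j)\in\mathcal{A}} \big(\beta^0_{ij}+\boldsymbol{\beta}_{ij}'\boldsymbol{\varepsilon}_{ij}\big)$ subject to $\sum_{k=1}^{n_{ij}}\big(\varepsilon^{(k)}_{ij}+\varepsilon^{(k)}_{ji}\big)\le n_{ij}$ for all $(i,j)\in\mathcal{A}$; $\sum_{k=1}^{n_{ij}}\varepsilon^{(k)}_{ij}\le \theta^{(l)}_{ij}$ for all $(i,j)\in\mathcal{A}$, $l=1,\dots,n_{ij}$; $\boldsymbol{\varepsilon}_{ij}\in\{0,1\}^{n_{ij}}$ for all $(i,j)\in\mathcal{A}$. If the integer variables $\boldsymbol{\varepsilon}$ are relaxed to be continuous (i.e. $\boldsymbol{\varepsilon}_{ij}\in\{0,1\}^{n_{ij}}$ is replaced by $\boldsymbol{\varepsilon}_{ij}\in[0,1]^{n_{ij}}$ for all $(i,j)\in\mathcal{A}$), then the solution to the relaxed program is an integer solution; that is, the resulting linear program can be solved with any linear programming method and is ensured to recover an integer solution.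
   Context: A transportation network is a strongly connected directed graph with node set $\mathcal{V}$ and arc set $\mathcal{A}$. For each arc $(i,j)\in\mathcal{A}$, $z_{ij}$ is the number of lanes assigned to it, $c_{ij}$ is its capacity per lane, $t^0_{ij}$ is its free-flow travel time, and $n_{ij}=n_{ji}$ is the sum of the numbers of lanes in arcs $(i,j)$ and $(j,i)$, hence the maximum number of lanes that can be assigned to either. If $(j,i)\notin\mathcal{A}$, the terms $\varepsilon^{(k)}_{ji}$ are read as $0$. The arc flows $x_{ij}\ge 0$ are fixed. The travel time on arc $(i,j)$ is $t_{ij}(x_{ij},z_{ij})=t^0_{ij}f\big(x_{ij}/(c_{ij}z_{ij})\big)$ with $f(x)=1+0.15x^4$, and the arc's cost is $J_{ij}=x_{ij}t_{ij}(x_{ij},z_{ij})$, a convex function of $z_{ij}$. The function $J_{ij}$ is approximated by a piecewise affine and convex function $\hat J_{ij}$ of the number of lanes, whose breakpoints are the thresholds $\boldsymbol{\theta}_{ij}=(1,\dots,n_{ij})$, with $k$-th entry $\theta^{(k)}_{ij}=k$. For each segment $(\theta^{(k)}_{ij},\theta^{(k+1)}_{ij})$, $\beta^{(k)}_{ij}$ is the slope of the corresponding affine segment (for $k=n_{ij}$, the segment starting at the last threshold), so that $\beta^{(k)}_{ij}\le\beta^{(k+1)}_{ij}$ by convexity; $\beta^0_{ij}$ is the intercept of the function. The vector $\boldsymbol{\varepsilon}_{ij}=(\varepsilon^{(1)}_{ij},\dots,\varepsilon^{(n_{ij})}_{ij})\in\{0,1\}^{n_{ij}}$ consists of $n_{ij}$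 slack variables, each corresponding to an assignment of one lane to arc $(i,j)$, so that $z_{ij}=\sum_{k=1}^{n_{ij}}\varepsilon^{(k)}_{ij}$; and $\boldsymbol{\varepsilon}=(\boldsymbol{\varepsilon}_{ij};\ (i,j)\in\mathcal{A})$. A prime denotes transpose.
   Formalization: With ties the relaxed program can have non-integer optima (zero slopes), so the proved claim is: an integer optimum exists, every optimal vertex is integer, and the relaxed optima are exactly the convex hull of the integer optima; the network is assumed to have no loops. *)

theory Defs
  imports "HOL-Analysis.Analysis" "HOL-Analysis.Finite_Function_Topology" "Graph_Theory.Pair_Digraph" "Graph_Theory.Digraph_Component"
begin

type_synonym 'v arc = "'v \<times> 'v"

definition bpr :: "real \<Rightarrow> real" where
  "bpr y = 1 + 0.15 * y ^ 4"

definition travel_time :: "real \<Rightarrow> real \<Rightarrow> real \<Rightarrow> real \<Rightarrow> real" where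
  "travel_time t0 c x z = t0 * bpr (x / (c * z))"

definition arc_cost :: "real \<Rightarrow> real \<Rightarrow> real \<Rightarrow> real \<Rightarrow> real" where
  "arc_cost t0 c x z = x * travel_time t0 c x z"

text \<open>The network fixes the lane totals \<open>n\<close> (shared by the two directions of a road), the free-flow
  times \<open>t0\<close>, the capacities per lane \<open>c\<close> and the flows \<open>x\<close>; \<open>pair_digraph\<close> makes it finite and
  loop-free. A loop would be its own reverse arc, so that its lanes would be counted twice in
  the capacity constraint below.\<close>

definition transport_network ::
  "'v pair_pre_digraph \<Rightarrow> ('v arc \<Rightarrow> nat) \<Rightarrow> ('v arc \<Rightarrow> real) \<Rightarrow> ('v arc \<Rightarrow> real) \<Rightarrow> ('v arc \<Rightarrow> real) \<Rightarrow> bool"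
where
  "transport_network G n t0 c x \<longleftrightarrow>
     pair_digraph G \<and> strongly_connected (with_proj G) \<and>
     (\<forall>(i, j) \<in> parcs G. n (i, j) = n (j, i)) \<and>
     (\<forall>e \<in> parcs G. 0 \<le> t0 e \<and> 0 < c e \<and> 0 \<le> x e)"

definition threshold :: "nat \<Rightarrow> real" where
  "threshold k = real k"

text \<open>The segment starting at the \<open>k\<close>-th of \<open>m\<close> thresholds; the last one is unbounded.\<close>

definition segment_from :: "nat \<Rightarrow> nat \<Rightarrow> real set" where
  "segment_from m k = (if k < m then {threshold k .. threshold (k + 1)} else {threshold k ..})"

text \<open>\<open>Jh\<close> is convex and piecewise affine with breakpoints \<open>1, \<dots>, m\<close>, intercept \<open>b0\<close>, and slope
  \<open>b k\<close> on the segment starting at the \<open>k\<close>-th threshold. Monotonicity of the slopes follows from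
  convexity. The slope of the initial piece, which precedes all thresholds, is left open.\<close>

definition pw_affine_convex :: "nat \<Rightarrow> real \<Rightarrow> (nat \<Rightarrow> real) \<Rightarrow> (real \<Rightarrow> real) \<Rightarrow> bool" where
  "pw_affine_convex m b0 b Jh \<longleftrightarrow>
     convex_on {0..} Jh \<and> Jh 0 = b0 \<and>
     (\<exists>s. \<forall>z \<in> {0..1}. Jh z = b0 + s * z) \<and>
     (\<forall>k \<in> {1..m}. \<forall>z \<in> segment_from m k. Jh z = Jh (threshold k) + b k * (z - threshold k))"

text \<open>The approximation scheme is not prescribed: the error bound \<open>d\<close> on the range of lane numbers
  is an arbitrary parameter.\<close>

definition pw_affine_convex_approx ::
  "nat \<Rightarrow> real \<Rightarrow> (nat \<Rightarrow> real) \<Rightarrow> real \<Rightarrow> (real \<Rightarrow> real) \<Rightarrow> (real \<Rightarrow> real) \<Rightarrow> bool" where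
  "pw_affine_convex_approx m b0 b d J Jh \<longleftrightarrow>
     pw_affine_convex m b0 b Jh \<and> (\<forall>z \<in> {1..real m}. \<bar>Jh z - J z\<bar> \<le> d)"

text \<open>A lane assignment is a finitely supported function of an arc and a lane index, a type that
  carries the vector space structure needed for convex hulls and extreme points. Restricting the
  support to the actual variables makes the value on a missing reverse arc zero.\<close>

type_synonym 'v assignment = "('v arc \<times> nat, real) poly_mapping"

abbreviation slack :: "'v assignment \<Rightarrow> 'v arc \<Rightarrow> nat \<Rightarrow> real" where
  "slack \<epsilon> e k \<equiv> Poly_Mapping.lookup \<epsilon> (e, k)"

definition lane_assignments :: "'v pair_pre_digraph \<Rightarrow> ('v arc \<Rightarrow> nat) \<Rightarrow> real set \<Rightarrow> 'v assignment set" where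
  "lane_assignments G n D = {\<epsilon>.
     Poly_Mapping.keys \<epsilon> \<subseteq> (SIGMA e : parcs G. {1..n e}) \<and>
     (\<forall>(i, j) \<in> parcs G. (\<Sum>k=1..n (i, j). slack \<epsilon> (i, j) k + slack \<epsilon> (j, i) k) \<le> real (n (i, j))) \<and>
     (\<forall>e \<in> parcs G. \<forall>l \<in> {1..n e}. (\<Sum>k=1..n e. slack \<epsilon> e k) \<le> threshold l) \<and>
     (\<forall>e \<in> parcs G. \<forall>k \<in> {1..n e}. slack \<epsilon> e k \<in> D)}"

definition integer_feasible :: "'v pair_pre_digraph \<Rightarrow> ('v arc \<Rightarrow> nat) \<Rightarrow> 'v assignment set" where
  "integer_feasible G n = lane_assignments G n {0, 1}"

definition relaxed_feasible :: "'v pair_pre_digraph \<Rightarrow> ('v arc \<Rightarrow> nat) \<Rightarrow> 'v assignment set" where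
  "relaxed_feasible G n = lane_assignments G n {0..1}"

definition approx_cost ::
  "'v pair_pre_digraph \<Rightarrow> ('v arc \<Rightarrow> nat) \<Rightarrow> ('v arc \<Rightarrow> real) \<Rightarrow> ('v arc \<Rightarrow> nat \<Rightarrow> real) \<Rightarrow> 'v assignment \<Rightarrow> real"
where
  "approx_cost G n \<beta>0 \<beta> \<epsilon> = (\<Sum>e \<in> parcs G. \<beta>0 e + (\<Sum>k=1..n e. \<beta> e k * slack \<epsilon> e k))"

definition integer_solutions ::
  "'v pair_pre_digraph \<Rightarrow> ('v arc \<Rightarrow> nat) \<Rightarrow> ('v arc \<Rightarrow> real) \<Rightarrow> ('v arc \<Rightarrow> nat \<Rightarrow> real) \<Rightarrow> 'v assignment set"
where
  "integer_solutions G n \<beta>0 \<beta> =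
     {\<epsilon>. is_arg_min (approx_cost G n \<beta>0 \<beta>) (\<lambda>\<epsilon>. \<epsilon> \<in> integer_feasible G n) \<epsilon>}"

definition relaxed_solutions ::
  "'v pair_pre_digraph \<Rightarrow> ('v arc \<Rightarrow> nat) \<Rightarrow> ('v arc \<Rightarrow> real) \<Rightarrow> ('v arc \<Rightarrow> nat \<Rightarrow> real) \<Rightarrow> 'v assignment set"
where
  "relaxed_solutions G n \<beta>0 \<beta> =
     {\<epsilon>. is_arg_min (approx_cost G n \<beta>0 \<beta>) (\<lambda>\<epsilon>. \<epsilon> \<in> relaxed_feasible G n) \<epsilon>}"

end

theory Submission
  imports Defs
begin

text \<open>The relaxation loses nothing because its feasible set is an integral polytope. The first threshold is \<open>1\<close>, so each arc carries at most one lane in total. A road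
  with at least two lanes then satisfies its capacity constraint automatically, and on a road with
  one lane the capacity constraint says that the total over both directions is at most \<open>1\<close>, which
  subsumes the two threshold constraints. Hence the variables split into disjoint blocks (the two
  directions of a one-lane road, or a single arc otherwise), and the feasible set is the product
  over the blocks of the corner simplices \<open>{p \<ge> 0. sum p \<le> 1}\<close> (\<open>relaxed_feasible_eq\<close>).

  A corner simplex is the convex hull of the origin and the unit vectors, and convex hulls commute
  with Minkowski sums, so the product is the convex hull of its \<open>0/1\<close> points
  (\<open>simplex_product_integral\<close>). The cost is affine, and the minimisers of an affine function over
  a convex hull are the convex hull of the minimising generators
  (\<open>affine_minimisers_convex_hull\<close>). Extreme points of a convex hull are generators, so the
  extreme optimal solutions are integral.\<close>

section \<open>Minimising an affine function over a convex hull\<close>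

text \<open>For the inclusion from left to right, let \<open>m\<close> be the minimum. The points at which \<open>f\<close> is at
  least \<open>m\<close>, and which lie in the right-hand side if the value is exactly \<open>m\<close>, form a convex set:
  a proper convex combination has value \<open>m\<close> only if both its points do. This set contains the
  generators, hence their convex hull.\<close>

lemma affine_minimisers_convex_hull:
  fixes f :: "'a::real_vector \<Rightarrow> real"
  assumes affine: "\<And>p q u v. u + v = 1 \<Longrightarrow> f (u *\<^sub>R p + v *\<^sub>R q) = u * f p + v * f q"
  shows "{p. is_arg_min f (\<lambda>p. p \<in> convex hull S) p} = convex hull {p. is_arg_min f (\<lambda>p. p \<in> S) p}"
    (is "?L = convex hull ?M")
proof
  show "?L \<subseteq> convex hull ?M"
  proof
    fix p assume p: "p \<in> ?L"
    define K where "K = {q. f p \<le> f q \<and> (f q = f p \<longrightarrow> q \<in> convex hull ?M)}"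
    have "S \<subseteq> K"
    proof
      fix q assume q: "q \<in> S"
      have min: "f p \<le> f r" if "r \<in> S" for r
        using p hull_inc[OF that, of convex] by (auto simp: is_arg_min_linorder)
      have "q \<in> ?M" if "f q = f p"
        using q min that by (auto simp: is_arg_min_linorder)
      then show "q \<in> K"
        using min[OF q] hull_inc[of q ?M convex] by (auto simp: K_def)
    qed
    moreover have "convex K"
    proof (rule convexI)
      fix q r :: 'a and u v :: real
      assume q: "q \<in> K" and r: "r \<in> K" and u: "0 \<le> u" and v: "0 \<le> v" and uv: "u + v = 1"
      have val: "f (u *\<^sub>R q + v *\<^sub>R r) - f p = u * (f q - f p) + v * (f r - f p)"
      proof -
        have "f p = u * f p + v * f p"
          using uv by (metis distrib_right mult_1)
        then show ?thesis
          using affine[OF uv, of q r] by (simp add: algebra_simps)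
      qed
      have q0: "0 \<le> u * (f q - f p)" and r0: "0 \<le> v * (f r - f p)"
        using q r u v by (auto simp: K_def)
      have "u *\<^sub>R q + v *\<^sub>R r \<in> convex hull ?M" if "f (u *\<^sub>R q + v *\<^sub>R r) = f p"
      proof -
        have z: "u * (f q - f p) = 0" "v * (f r - f p) = 0"
          using val q0 r0 that by linarith+
        consider "u = 0" | "v = 0" | "f q = f p" "f r = f p"
          using z by auto
        then show ?thesis
        proof cases
          case 3
          then have "q \<in> convex hull ?M" "r \<in> convex hull ?M"
            using q r by (auto simp: K_def)
          then show ?thesis
            using convexD[OF convex_convex_hull _ _ u v uv] by blast
        qed (use q r uv that in \<open>auto simp: K_def\<close>)
      qed
      then show "u *\<^sub>R q + v *\<^sub>R r \<in> K"
        using val q0 r0 by (auto simp: K_def)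
    qed
    ultimately have "convex hull S \<subseteq> K"
      by (rule hull_minimal)
    then show "p \<in> convex hull ?M"
      using p by (auto simp: K_def is_arg_min_linorder)
  qed
next
  have above: "convex {q. c \<le> f q}" for c
  proof (rule convexI)
    fix q r :: 'a and u v :: real
    assume *: "q \<in> {q. c \<le> f q}" "r \<in> {q. c \<le> f q}" "0 \<le> u" "0 \<le> v" "u + v = 1"
    then have "u * c + v * c \<le> u * f q + v * f r"
      by (intro add_mono mult_left_mono) auto
    moreover have "u * c + v * c = c"
      using \<open>u + v = 1\<close> by (metis distrib_right mult_1)
    ultimately show "u *\<^sub>R q + v *\<^sub>R r \<in> {q. c \<le> f q}"
      using affine[OF \<open>u + v = 1\<close>] by simp
  qed
  have min: "f p \<le> f q" if "p \<in> ?M" "q \<in> convex hull S" for p q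
  proof -
    have "convex hull S \<subseteq> {q. f p \<le> f q}"
      using that(1) by (intro hull_minimal above) (auto simp: is_arg_min_linorder)
    then show ?thesis
      using that(2) by auto
  qed
  have "?M \<subseteq> ?L"
    using min by (auto simp: is_arg_min_linorder hull_inc)
  moreover have "convex ?L"
  proof (rule convexI)
    fix q r :: 'a and u v :: real
    assume q: "q \<in> ?L" and r: "r \<in> ?L" and u: "0 \<le> u" "0 \<le> v" and uv: "u + v = 1"
    have "f q = f r"
      using q r by (auto simp: is_arg_min_linorder intro: antisym)
    then have "f (u *\<^sub>R q + v *\<^sub>R r) = f q"
      using affine[OF uv, of q r] uv by (metis distrib_right mult_1)
    moreover have "u *\<^sub>R q + v *\<^sub>R r \<in> convex hull S"
      using q r convexD[OF convex_convex_hull _ _ u uv] by (auto simp: is_arg_min_linorder)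
    ultimately show "u *\<^sub>R q + v *\<^sub>R r \<in> ?L"
      using q by (auto simp: is_arg_min_linorder)
  qed
  ultimately show "convex hull ?M \<subseteq> ?L"
    by (rule hull_minimal)
qed

section \<open>Products of corner simplices are integral\<close>

lemma lookup_scaleR: "Poly_Mapping.lookup (c *\<^sub>R p) a = c *\<^sub>R Poly_Mapping.lookup p a"
proof -
  have "finite {a. c *\<^sub>R Poly_Mapping.lookup p a \<noteq> 0}"
    by (rule finite_subset[OF _ finite_keys[of p]]) (auto simp: in_keys_iff)
  then show ?thesis
    by (simp add: scaleR_poly_mapping_def Abs_poly_mapping_inverse)
qed

definition simplex_product :: "'a set set \<Rightarrow> ('a \<Rightarrow>\<^sub>0 real) set" where
  "simplex_product F = {p. Poly_Mapping.keys p \<subseteq> \<Union>F \<and> (\<forall>a. 0 \<le> Poly_Mapping.lookup p a) \<and>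
     (\<forall>C \<in> F. (\<Sum>a\<in>C. Poly_Mapping.lookup p a) \<le> 1)}"

lemma convex_simplex_product: "convex (simplex_product F)"
proof (rule convexI)
  fix p q :: "'a \<Rightarrow>\<^sub>0 real" and u v :: real
  assume p: "p \<in> simplex_product F" and q: "q \<in> simplex_product F"
    and u: "0 \<le> u" and v: "0 \<le> v" and uv: "u + v = 1"
  have lookup: "Poly_Mapping.lookup (u *\<^sub>R p + v *\<^sub>R q) a
      = u * Poly_Mapping.lookup p a + v * Poly_Mapping.lookup q a" for a
    by (simp add: lookup_add lookup_scaleR)
  have "Poly_Mapping.keys (u *\<^sub>R p + v *\<^sub>R q) \<subseteq> Poly_Mapping.keys p \<union> Poly_Mapping.keys q"
    by (auto simp: in_keys_iff lookup)
  then have "Poly_Mapping.keys (u *\<^sub>R p + v *\<^sub>R q) \<subseteq> \<Union>F"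
    using p q by (auto simp: simplex_product_def)
  moreover have "(\<Sum>a\<in>C. Poly_Mapping.lookup (u *\<^sub>R p + v *\<^sub>R q) a) \<le> 1" if "C \<in> F" for C
  proof -
    have "(\<Sum>a\<in>C. Poly_Mapping.lookup (u *\<^sub>R p + v *\<^sub>R q) a)
        = u * (\<Sum>a\<in>C. Poly_Mapping.lookup p a) + v * (\<Sum>a\<in>C. Poly_Mapping.lookup q a)"
      by (simp add: lookup sum.distrib sum_distrib_left)
    also have "\<dots> \<le> u * 1 + v * 1"
      using p q u v that by (intro add_mono mult_left_mono) (auto simp: simplex_product_def)
    finally show ?thesis
      using uv by simp
  qed
  ultimately show "u *\<^sub>R p + v *\<^sub>R q \<in> simplex_product F"
    using p q u v by (auto simp: simplex_product_def lookup)
qed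

text \<open>The weights are the coordinates, and the origin takes up the slack in \<open>sum w C \<le> 1\<close>.\<close>

lemma corner_simplex_in_hull:
  fixes w :: "'a \<Rightarrow> real"
  assumes C: "finite C" and w: "\<And>a. a \<in> C \<Longrightarrow> 0 \<le> w a" "sum w C \<le> 1"
  shows "(\<Sum>a\<in>C. Poly_Mapping.single a (w a))
    \<in> convex hull (insert 0 ((\<lambda>a. Poly_Mapping.single a 1) ` C))" (is "_ \<in> convex hull ?V")
proof -
  define u where "u = case_option (1 - sum w C) w"
  define y where "y = case_option (0 :: 'a \<Rightarrow>\<^sub>0 real) (\<lambda>a. Poly_Mapping.single a 1)"
  let ?I = "insert None (Some ` C)"
  have "(\<Sum>i\<in>?I. u i *\<^sub>R y i) \<in> convex hull ?V"
  proof (rule convex_sum)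
    show "y i \<in> convex hull ?V" if "i \<in> ?I" for i
      using that by (intro hull_inc) (auto simp: y_def)
    show "sum u ?I = 1"
      using C by (simp add: sum.reindex u_def)
    show "0 \<le> u i" if "i \<in> ?I" for i
      using that w by (auto simp: u_def)
  qed (use C in auto)
  moreover have "w a *\<^sub>R Poly_Mapping.single a 1 = Poly_Mapping.single a (w a)" for a
    by (rule poly_mapping_eqI) (simp add: lookup_scaleR lookup_single when_def)
  then have "(\<Sum>i\<in>?I. u i *\<^sub>R y i) = (\<Sum>a\<in>C. Poly_Mapping.single a (w a))"
    using C by (simp add: sum.reindex u_def y_def)
  ultimately show ?thesis
    by simp
qed

text \<open>A point is the Minkowski sum of its restrictions to the blocks. Taking hulls blockwise and
  exchanging hull and sum leaves sums of one vertex (a unit vector or the origin) per block, and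
  these are the \<open>0/1\<close> points because the blocks are disjoint.\<close>

theorem simplex_product_integral:
  fixes F :: "'a set set"
  assumes F: "finite F" "\<And>C. C \<in> F \<Longrightarrow> finite C" and disj: "disjoint F"
  shows "simplex_product F
    = convex hull {p \<in> simplex_product F. \<forall>a. Poly_Mapping.lookup p a \<in> {0, 1}}"
    (is "_ = convex hull ?Z")
proof
  define V where "V C = insert 0 ((\<lambda>a. Poly_Mapping.single a (1::real)) ` C)" for C :: "'a set"
  have V_lookup: "Poly_Mapping.lookup v a \<in> {0, 1}" "a \<notin> C \<Longrightarrow> Poly_Mapping.lookup v a = 0"
    if "v \<in> V C" for v :: "'a \<Rightarrow>\<^sub>0 real" and a C
    using that by (auto simp: V_def lookup_single when_def)
  have V_sum: "(\<Sum>a\<in>C. Poly_Mapping.lookup v a) \<le> 1" if "v \<in> V C" "finite C" for v C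
    using that by (auto simp: V_def lookup_single when_def)
  have one_block: "(\<Sum>D\<in>F. g D) = g C" if "a \<in> C" "C \<in> F" "\<And>D. D \<in> F \<Longrightarrow> a \<notin> D \<Longrightarrow> g D = 0"
    for g :: "'a set \<Rightarrow> real" and a C
  proof -
    have "g D = 0" if "D \<in> F - {C}" for D
      using that \<open>a \<in> C\<close> \<open>C \<in> F\<close> disj \<open>\<And>D. D \<in> F \<Longrightarrow> a \<notin> D \<Longrightarrow> g D = 0\<close>
      by (metis DiffD1 DiffD2 IntI disjointD emptyE singletonI)
    then have "sum g (F - {C}) = 0"
      by simp
    then show ?thesis
      using F(1) \<open>C \<in> F\<close> by (simp add: sum.remove)
  qed
  show "simplex_product F \<subseteq> convex hull ?Z"
  proof
    fix p assume p: "p \<in> simplex_product F"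
    define r where "r C = (\<Sum>a\<in>C. Poly_Mapping.single a (Poly_Mapping.lookup p a))" for C
    have r_lookup: "Poly_Mapping.lookup (r C) a = (if a \<in> C then Poly_Mapping.lookup p a else 0)"
      if "C \<in> F" for C a
      using F(2)[OF that] by (simp add: r_def lookup_sum lookup_single when_def)
    have "p = (\<Sum>C\<in>F. r C)"
    proof (rule poly_mapping_eqI)
      fix a
      show "Poly_Mapping.lookup p a = Poly_Mapping.lookup (\<Sum>C\<in>F. r C) a"
      proof (cases "a \<in> \<Union>F")
        case True
        then obtain C where C: "a \<in> C" "C \<in> F" by auto
        then show ?thesis
          using one_block[OF C, of "\<lambda>C. Poly_Mapping.lookup (r C) a"] by (simp add: lookup_sum r_lookup)
      next
        case False
        then have "Poly_Mapping.lookup p a = 0"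
          using p by (auto simp: simplex_product_def in_keys_iff)
        with False show ?thesis
          by (auto simp: lookup_sum r_lookup intro!: sum.neutral[symmetric])
      qed
    qed
    moreover have "r C \<in> convex hull V C" if "C \<in> F" for C
      unfolding r_def V_def
      using p that F(2) by (intro corner_simplex_in_hull) (auto simp: simplex_product_def)
    ultimately have "p \<in> convex hull (\<Sum>C\<in>F. V C)"
      unfolding convex_hull_set_sum by (subst set_sum_alt[OF F(1)]) blast
    moreover have "(\<Sum>C\<in>F. V C) \<subseteq> ?Z"
    proof
      fix q assume "q \<in> (\<Sum>C\<in>F. V C)"
      then obtain s where q: "q = (\<Sum>C\<in>F. s C)" and s: "\<And>C. C \<in> F \<Longrightarrow> s C \<in> V C"
        by (auto simp: set_sum_alt[OF F(1)])
      have in_block: "Poly_Mapping.lookup q a = Poly_Mapping.lookup (s C) a"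
        if "a \<in> C" "C \<in> F" for a C
        using one_block[OF that, of "\<lambda>C. Poly_Mapping.lookup (s C) a"] V_lookup(2)[OF s]
        by (simp add: q lookup_sum)
      have outside: "Poly_Mapping.lookup q a = 0" if "a \<notin> \<Union>F" for a
        using that V_lookup(2)[OF s] by (auto simp: q lookup_sum intro!: sum.neutral)
      have 01: "Poly_Mapping.lookup q a \<in> {0, 1}" for a
        using outside in_block s V_lookup(1) by (cases "a \<in> \<Union>F") (fastforce, simp)
      have "0 \<le> Poly_Mapping.lookup q a" for a
        using 01[of a] by auto
      moreover have "(\<Sum>a\<in>C. Poly_Mapping.lookup q a) \<le> 1" if "C \<in> F" for C
        using V_sum[OF s F(2)] that by (simp add: in_block)
      moreover have "Poly_Mapping.keys q \<subseteq> \<Union>F"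
        using outside by (meson in_keys_iff subsetI)
      ultimately show "q \<in> ?Z"
        using 01 by (auto simp: simplex_product_def)
    qed
    ultimately show "p \<in> convex hull ?Z"
      using hull_mono by blast
  qed
  show "convex hull ?Z \<subseteq> simplex_product F"
    by (rule hull_minimal) (auto intro: convex_simplex_product)
qed

section \<open>The feasible sets of the lane assignment problem\<close>

text \<open>Of the two directions of a one-lane road at most one can be opened, so their variables share
  a block.\<close>

definition lane_block :: "'v pair_pre_digraph \<Rightarrow> ('v arc \<Rightarrow> nat) \<Rightarrow> 'v arc \<Rightarrow> ('v arc \<times> nat) set" where
  "lane_block G n e = insert e (if n e = 1 then {prod.swap e} \<inter> parcs G else {}) \<times> {1..n e}"

abbreviation lane_blocks :: "'v pair_pre_digraph \<Rightarrow> ('v arc \<Rightarrow> nat) \<Rightarrow> ('v arc \<times> nat) set set" where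
  "lane_blocks G n \<equiv> lane_block G n ` parcs G"

lemma lane_block_eq:
  assumes "\<And>e. e \<in> parcs G \<Longrightarrow> n (prod.swap e) = n e" "e \<in> parcs G" "(e', k) \<in> lane_block G n e"
  shows "e' \<in> parcs G" "k \<in> {1..n e'}" "lane_block G n e' = lane_block G n e"
  using assms(1)[of e] assms(2,3) by (auto simp: lane_block_def split: if_splits)

lemma Union_lane_blocks:
  assumes "\<And>e. e \<in> parcs G \<Longrightarrow> n (prod.swap e) = n e"
  shows "\<Union>(lane_blocks G n) = (SIGMA e : parcs G. {1..n e})"
proof
  show "\<Union>(lane_blocks G n) \<subseteq> (SIGMA e : parcs G. {1..n e})"
  proof
    fix a assume "a \<in> \<Union>(lane_blocks G n)"
    then obtain e where "e \<in> parcs G" "(fst a, snd a) \<in> lane_block G n e"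
      by auto
    then have "fst a \<in> parcs G" "snd a \<in> {1..n (fst a)}"
      using lane_block_eq[of G n, OF assms] by blast+
    then show "a \<in> (SIGMA e : parcs G. {1..n e})"
      by (cases a) auto
  qed
  show "(SIGMA e : parcs G. {1..n e}) \<subseteq> \<Union>(lane_blocks G n)"
    by (auto simp: lane_block_def)
qed

lemma disjoint_lane_blocks:
  assumes "\<And>e. e \<in> parcs G \<Longrightarrow> n (prod.swap e) = n e"
  shows "disjoint (lane_blocks G n)"
proof (rule disjointI)
  fix B C
  assume B: "B \<in> lane_blocks G n" and C: "C \<in> lane_blocks G n" and "B \<noteq> C"
  from B C obtain e f where ef: "e \<in> parcs G" "f \<in> parcs G"
      "B = lane_block G n e" "C = lane_block G n f"
    by auto
  have False if "(e', k) \<in> B" "(e', k) \<in> C" for e' k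
    using lane_block_eq(3)[of G n, OF assms] ef that \<open>B \<noteq> C\<close> by metis
  then show "B \<inter> C = {}"
    by auto
qed

lemma sum_lane_block:
  fixes h :: "'v arc \<times> nat \<Rightarrow> real"
  assumes "prod.swap e \<noteq> e"
  shows "sum h (lane_block G n e) = (\<Sum>k=1..n e. h (e, k)) +
    (if n e = 1 \<and> prod.swap e \<in> parcs G then h (prod.swap e, 1) else 0)"
proof (cases "n e = 1 \<and> prod.swap e \<in> parcs G")
  case True
  then have "lane_block G n e = {(e, 1), (prod.swap e, 1)}"
    by (auto simp: lane_block_def)
  then show ?thesis
    using True assms by simp
next
  case False
  then have "lane_block G n e = Pair e ` {1..n e}"
    by (auto simp: lane_block_def)
  then show ?thesis
    using False by (auto simp: sum.reindex inj_on_def)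
qed

text \<open>The threshold constraints amount to a total of at most \<open>1\<close> on each arc with lanes. The capacity
  constraint is the block constraint if the road has one lane; if it has more, it follows from
  \<open>1 + 1 \<le> n\<close>. Absence of loops makes the reverse of an arc a different variable.\<close>

theorem relaxed_feasible_eq:
  assumes sym: "\<And>e. e \<in> parcs G \<Longrightarrow> n (prod.swap e) = n e"
    and loopfree: "\<And>e. e \<in> parcs G \<Longrightarrow> prod.swap e \<noteq> e"
  shows "relaxed_feasible G n = simplex_product (lane_blocks G n)"
proof
  have union: "\<Union>(lane_blocks G n) = (SIGMA e : parcs G. {1..n e})"
    using sym by (rule Union_lane_blocks)
  show "relaxed_feasible G n \<subseteq> simplex_product (lane_blocks G n)"
  proof
    fix \<epsilon> assume "\<epsilon> \<in> relaxed_feasible G n"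
    then have keys: "Poly_Mapping.keys \<epsilon> \<subseteq> (SIGMA e : parcs G. {1..n e})"
      and cap: "\<And>e. e \<in> parcs G \<Longrightarrow>
        (\<Sum>k=1..n e. slack \<epsilon> e k + slack \<epsilon> (prod.swap e) k) \<le> real (n e)"
      and thr: "\<And>e l. e \<in> parcs G \<Longrightarrow> l \<in> {1..n e} \<Longrightarrow> (\<Sum>k=1..n e. slack \<epsilon> e k) \<le> real l"
      and box: "\<And>e k. e \<in> parcs G \<Longrightarrow> k \<in> {1..n e} \<Longrightarrow> slack \<epsilon> e k \<in> {0..1}"
      by (fastforce simp: relaxed_feasible_def lane_assignments_def threshold_def)+
    have "0 \<le> slack \<epsilon> e k" for e k
      using keys box[of e k] by (cases "(e, k) \<in> Poly_Mapping.keys \<epsilon>") (auto simp: in_keys_iff)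
    moreover have "sum (Poly_Mapping.lookup \<epsilon>) (lane_block G n e) \<le> 1" if e: "e \<in> parcs G" for e
    proof (cases "n e = 1 \<and> prod.swap e \<in> parcs G")
      case True
      then show ?thesis
        using cap[OF e] by (simp add: sum_lane_block[OF loopfree[OF e]])
    next
      case False
      then show ?thesis
        using thr[OF e, of 1] by (cases "n e = 0") (auto simp: sum_lane_block[OF loopfree[OF e]])
    qed
    ultimately show "\<epsilon> \<in> simplex_product (lane_blocks G n)"
      using keys unfolding simplex_product_def union by auto
  qed
  show "simplex_product (lane_blocks G n) \<subseteq> relaxed_feasible G n"
  proof
    fix \<epsilon> assume \<epsilon>: "\<epsilon> \<in> simplex_product (lane_blocks G n)"
    have keys: "Poly_Mapping.keys \<epsilon> \<subseteq> (SIGMA e : parcs G. {1..n e})"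
      using \<epsilon> unfolding simplex_product_def union by blast
    have nonneg: "0 \<le> slack \<epsilon> e k" for e k
      using \<epsilon> unfolding simplex_product_def by blast
    have block: "(\<Sum>k=1..n e. slack \<epsilon> e k) +
        (if n e = 1 \<and> prod.swap e \<in> parcs G then slack \<epsilon> (prod.swap e) 1 else 0) \<le> 1"
      if "e \<in> parcs G" for e
      using \<epsilon> that sum_lane_block[OF loopfree[OF that], of "Poly_Mapping.lookup \<epsilon>" G n]
      by (auto simp: simplex_product_def)
    have arc: "(\<Sum>k=1..n e. slack \<epsilon> e k) \<le> 1" if "e \<in> parcs G" for e
      using block[OF that] nonneg[of "prod.swap e" 1] by (auto split: if_splits)
    have missing: "slack \<epsilon> e k = 0" if "e \<notin> parcs G" for e k
      using keys that by (auto simp: in_keys_iff)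
    have cap: "(\<Sum>k=1..n e. slack \<epsilon> e k + slack \<epsilon> (prod.swap e) k) \<le> real (n e)"
      if e: "e \<in> parcs G" for e
    proof -
      consider "n e = 0" | "n e = 1" | "2 \<le> n e"
        by linarith
      then show ?thesis
      proof cases
        case 2
        then show ?thesis
          using block[OF e] missing[of "prod.swap e" 1] by (auto split: if_splits)
      next
        case 3
        have "(\<Sum>k=1..n e. slack \<epsilon> (prod.swap e) k) \<le> 1"
          using arc[of "prod.swap e"] sym[OF e] missing[of "prod.swap e"]
          by (cases "prod.swap e \<in> parcs G") auto
        then have "(\<Sum>k=1..n e. slack \<epsilon> e k + slack \<epsilon> (prod.swap e) k) \<le> 2"
          using arc[OF e] by (simp add: sum.distrib)
        then show ?thesis
          using 3 by linarith
      qed simp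
    qed
    have thr: "(\<Sum>k=1..n e. slack \<epsilon> e k) \<le> real l" if "e \<in> parcs G" "l \<in> {1..n e}" for e l
      using arc[OF that(1)] that(2) by simp
    have le1: "slack \<epsilon> e k \<le> 1" if "e \<in> parcs G" "k \<in> {1..n e}" for e k
      using member_le_sum[of k "{1..n e}" "slack \<epsilon> e"] nonneg arc[OF that(1)] that(2) by fastforce
    have "(\<Sum>k=1..n (i, j). slack \<epsilon> (i, j) k + slack \<epsilon> (j, i) k) \<le> real (n (i, j))"
      if "(i, j) \<in> parcs G" for i j
      using cap[OF that] by simp
    then show "\<epsilon> \<in> relaxed_feasible G n"
      using keys thr le1 nonneg by (auto simp: relaxed_feasible_def lane_assignments_def threshold_def)
  qed
qed

lemma integer_feasible_eq:
  "integer_feasible G n = {\<epsilon> \<in> relaxed_feasible G n. \<forall>a. Poly_Mapping.lookup \<epsilon> a \<in> {0, 1}}"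
proof -
  have "(\<forall>e \<in> parcs G. \<forall>k \<in> {1..n e}. slack \<epsilon> e k \<in> {0, 1}) \<longleftrightarrow>
      (\<forall>e \<in> parcs G. \<forall>k \<in> {1..n e}. slack \<epsilon> e k \<in> {0..1}) \<and> (\<forall>a. Poly_Mapping.lookup \<epsilon> a \<in> {0, 1})"
    (is "?B \<longleftrightarrow> ?R") if keys: "Poly_Mapping.keys \<epsilon> \<subseteq> (SIGMA e : parcs G. {1..n e})" for \<epsilon>
  proof
    assume B: ?B
    have "slack \<epsilon> e k \<in> {0, 1}" for e k
    proof (cases "(e, k) \<in> Poly_Mapping.keys \<epsilon>")
      case True
      then show ?thesis
        using B keys by blast
    qed (simp add: in_keys_iff)
    moreover from this have "slack \<epsilon> e k \<in> {0..1}" for e k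
      by (metis atLeastAtMost_iff empty_iff insert_iff order_refl zero_le_one)
    ultimately show ?R
      by (metis surj_pair)
  next
    assume ?R
    then show ?B
      by blast
  qed
  then show ?thesis
    unfolding integer_feasible_def relaxed_feasible_def lane_assignments_def by blast
qed

lemma finite_integer_feasible:
  assumes "finite (parcs G)"
  shows "finite (integer_feasible G n)"
proof (rule finite_imageD)
  have "Poly_Mapping.keys ` integer_feasible G n \<subseteq> Pow (SIGMA e : parcs G. {1..n e})"
    by (auto simp: integer_feasible_def lane_assignments_def)
  then show "finite (Poly_Mapping.keys ` integer_feasible G n)"
    by (rule finite_subset) (use assms in auto)
  \<comment> \<open>A function with values \<open>0\<close> and \<open>1\<close> is the indicator of its support.\<close>
  show "inj_on Poly_Mapping.keys (integer_feasible G n)"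
  proof (rule inj_onI)
    fix \<epsilon> \<epsilon>' assume "\<epsilon> \<in> integer_feasible G n" "\<epsilon>' \<in> integer_feasible G n"
    then have 01: "Poly_Mapping.lookup \<epsilon> a \<in> {0, 1}" "Poly_Mapping.lookup \<epsilon>' a \<in> {0, 1}" for a
      unfolding integer_feasible_eq by blast+
    assume keys: "Poly_Mapping.keys \<epsilon> = Poly_Mapping.keys \<epsilon>'"
    show "\<epsilon> = \<epsilon>'"
    proof (rule poly_mapping_eqI)
      show "Poly_Mapping.lookup \<epsilon> a = Poly_Mapping.lookup \<epsilon>' a" for a
        using 01[of a] keys by (metis in_keys_iff empty_iff insert_iff)
    qed
  qed
qed

lemma zero_integer_feasible: "0 \<in> integer_feasible G n"
  by (auto simp: integer_feasible_def lane_assignments_def threshold_def)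

lemma approx_cost_affine:
  assumes "u + v = 1"
  shows "approx_cost G n \<beta>0 \<beta> (u *\<^sub>R p + v *\<^sub>R q)
    = u * approx_cost G n \<beta>0 \<beta> p + v * approx_cost G n \<beta>0 \<beta> q"
proof -
  have "\<beta>0 e + (\<Sum>k=1..n e. \<beta> e k * slack (u *\<^sub>R p + v *\<^sub>R q) e k)
      = u * (\<beta>0 e + (\<Sum>k=1..n e. \<beta> e k * slack p e k))
        + v * (\<beta>0 e + (\<Sum>k=1..n e. \<beta> e k * slack q e k))" for e
  proof -
    have "(\<Sum>k=1..n e. \<beta> e k * slack (u *\<^sub>R p + v *\<^sub>R q) e k)
        = u * (\<Sum>k=1..n e. \<beta> e k * slack p e k) + v * (\<Sum>k=1..n e. \<beta> e k * slack q e k)"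
      by (simp add: lookup_add lookup_scaleR algebra_simps sum.distrib sum_distrib_left)
    moreover have "\<beta>0 e = u * \<beta>0 e + v * \<beta>0 e"
      using assms by (metis distrib_right mult_1)
    ultimately show ?thesis
      unfolding distrib_left by linarith
  qed
  then show ?thesis
    unfolding approx_cost_def by (simp only: sum.distrib flip: sum_distrib_left)
qed

section \<open>Exactness of the relaxation\<close>

theorem mainTheorem2:
  fixes G :: "'v pair_pre_digraph"
    and n :: "'v arc \<Rightarrow> nat"
    and t0 c x \<beta>0 \<delta> :: "'v arc \<Rightarrow> real"
    and \<beta> :: "'v arc \<Rightarrow> nat \<Rightarrow> real"
    and Jhat :: "'v arc \<Rightarrow> real \<Rightarrow> real"
  assumes "transport_network G n t0 c x"
    and "\<And>e. e \<in> parcs G \<Longrightarrow>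
      pw_affine_convex_approx (n e) (\<beta>0 e) (\<beta> e) (\<delta> e) (arc_cost (t0 e) (c e) (x e)) (Jhat e)"
  shows "(\<exists>\<epsilon>. \<epsilon> \<in> relaxed_solutions G n \<beta>0 \<beta> \<and> \<epsilon> \<in> integer_solutions G n \<beta>0 \<beta>) \<and>
    (\<forall>\<epsilon> \<in> relaxed_solutions G n \<beta>0 \<beta>. \<epsilon> extreme_point_of relaxed_feasible G n \<longrightarrow>
      \<epsilon> \<in> integer_solutions G n \<beta>0 \<beta>) \<and>
    relaxed_solutions G n \<beta>0 \<beta> = convex hull (integer_solutions G n \<beta>0 \<beta>)"
proof -
  interpret pair_digraph G
    using assms(1) by (simp add: transport_network_def)
  have sym: "n (prod.swap e) = n e" if "e \<in> parcs G" for e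
    using assms(1) that by (cases e) (auto simp: transport_network_def)
  have loopfree: "prod.swap e \<noteq> e" if "e \<in> parcs G" for e
    using pair_no_loops[OF that] by (cases e) auto
  have product: "relaxed_feasible G n = simplex_product (lane_blocks G n)"
    using sym loopfree by (rule relaxed_feasible_eq)
  have disj: "disjoint (lane_blocks G n)"
    using sym by (rule disjoint_lane_blocks)
  have hull: "relaxed_feasible G n = convex hull (integer_feasible G n)"
    unfolding integer_feasible_eq product
    by (rule simplex_product_integral[OF _ _ disj]) (auto simp: pair_finite_arcs lane_block_def)
  have solutions: "relaxed_solutions G n \<beta>0 \<beta> = convex hull (integer_solutions G n \<beta>0 \<beta>)"
    unfolding relaxed_solutions_def integer_solutions_def hull
    by (rule affine_minimisers_convex_hull[OF approx_cost_affine])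
  have "\<exists>\<epsilon>. is_arg_min (approx_cost G n \<beta>0 \<beta>) (\<lambda>\<epsilon>. \<epsilon> \<in> integer_feasible G n) \<epsilon>"
    using finite_integer_feasible[OF pair_finite_arcs] zero_integer_feasible
    by (intro ex_is_arg_min_if_finite) blast+
  then obtain \<epsilon> where "\<epsilon> \<in> integer_solutions G n \<beta>0 \<beta>"
    by (auto simp: integer_solutions_def)
  then have "\<exists>\<epsilon>. \<epsilon> \<in> relaxed_solutions G n \<beta>0 \<beta> \<and> \<epsilon> \<in> integer_solutions G n \<beta>0 \<beta>"
    using solutions hull_inc by metis
  moreover have "\<epsilon> \<in> integer_solutions G n \<beta>0 \<beta>"
    if opt: "\<epsilon> \<in> relaxed_solutions G n \<beta>0 \<beta>" and ext: "\<epsilon> extreme_point_of relaxed_feasible G n" for \<epsilon>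
  proof -
    have "\<epsilon> \<in> integer_feasible G n"
      using ext unfolding hull by (rule extreme_point_of_convex_hull)
    then show ?thesis
      using opt hull_inc[of _ "integer_feasible G n" convex]
      by (auto simp: relaxed_solutions_def integer_solutions_def is_arg_min_def hull)
  qed
  ultimately show ?thesis
    using solutions by blast
qed

end
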